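(* Let $X$ be an abelian surface over a field, $H$ an ample divisor on $X$, $\beta\in \mathrm{NS}(X)_{\mathbb R}$. Let $v$ and $v_2$ be Mukai vectors of ranks $r$ and $r_2$, written as $$v=re^\beta+(d_\beta H+D_\beta)+(d_\beta H+D_\beta,\beta)\varrho_X+a_\beta\varrho_X,\qquad v_2=r_2e^\beta+(d_2H+D_2)+(d_2H+D_2,\beta)\varrho_X+a_2\varrho_X$$ with $d_\beta,a_\beta,d_2,a_2\in\mathbb R$ and $D_\beta,D_2\in H^\perp\subset\mathrm{NS}(X)_{\mathbb R}$. Assume $r=0$ and $\langle v^2\rangle>0$. If $rd_2-r_2d_\beta\neq0$, then $\mathbb R Z_{(\beta+sH,tH)}(v)=\mathbb R Z_{(\beta+sH,tH)}(v_2)$ holds for $(s,t)\in\mathbb R^2$, $t>0$, if and only if $$t^2+\left(s-\frac{a_\beta}{d_\beta(H^2)}\right)^2=\left(\frac{a_\beta}{d_\beta(H^2)}-\frac{d_2}{r_2}\right)^2-\frac{\langle v_2^2\rangle-(D_2^2)}{r_2^2(H^2)}.$$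
   Context: $H^*(X,\mathbb Z)_{\mathrm{alg}}=\mathbb Z\oplus \mathrm{NS}(X)\oplus\mathbb Z\varrho_X$ ($\varrho_X$ the fundamental class, i.e. the class of a point) carries the Mukai pairing $\langle x,y\rangle=(x_1,y_1)-(x_0y_2+x_2y_0)$; its elements are called Mukai vectors and the rank of $x$ is $x_0$. $e^\beta=1+\beta+\frac{(\beta^2)}2\varrho_X$. The stability function is $Z_{(\beta,\omega)}(v)=\langle e^{\beta+\sqrt{-1}\omega},v\rangle$ (pairing extended $\mathbb C$-linearly), and $\mathbb RZ$ denotes the real span of the complex number $Z$.
   Formalization: The formal theorem additionally assumes Z_{(β+sH,tH)}(v_2) ≠ 0; where Z(v_2) = 0 the circle equation holds but the real spans differ, so the printed equivalence fails exactly at those points. *)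

theory Defs
  imports "HOL-Analysis.Analysis"
begin

text \<open>
  The libraries have no algebraic surfaces.  An abelian surface X over a field enters through its
  numerical data: the real vector space NS(X) tensor R (the type \<open>'a\<close>), the Neron-Severi
  lattice NS(X) inside it (NS of an abelian surface is torsion free, so nothing is lost in this
  embedding), the real extension of the intersection form, and the set of ample classes.  The
  axioms are standard theorems on abelian surfaces over an arbitrary field: NS(X) is free of
  finite rank; by Riemann-Roch (D^2)/2 is the integer \<open>\<chi>(D)\<close>; the Hodge index theorem,
  strict because numerically trivial classes vanish in NS(X); a projective surface has an ample
  class; and, since X is abelian, a class is ample iff it has positive square and positive
  intersection number with one ample class.
\<close>

locale abelian_surface_NS =
  fixes NS :: "'a::real_vector set"
    and ip :: "'a \<Rightarrow> 'a \<Rightarrow> real"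
    and Ample :: "'a set"
  assumes NS_lattice:
      "\<exists>B. finite B \<and> independent B \<and> span B = UNIV \<and>
           NS = {\<Sum>b\<in>B. of_int (c b) *\<^sub>R b | c :: 'a \<Rightarrow> int. True}"
    and ip_linear: "\<And>x. linear (ip x)"
    and ip_sym: "\<And>x y. ip x y = ip y x"
    and ip_integral: "\<And>D E. D \<in> NS \<Longrightarrow> E \<in> NS \<Longrightarrow> ip D E \<in> \<int>"
    and ip_even: "\<And>D. D \<in> NS \<Longrightarrow> ip D D / 2 \<in> \<int>"
    and Hodge_index: "\<And>x y. ip x x > 0 \<Longrightarrow> ip x y = 0 \<Longrightarrow> y \<noteq> 0 \<Longrightarrow> ip y y < 0"
    and Ample_nonempty: "Ample \<noteq> {}"
    and Ample_iff: "\<And>A D. A \<in> Ample \<Longrightarrow> D \<in> Ample \<longleftrightarrow> D \<in> NS \<and> ip D D > 0 \<and> ip A D > 0"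

type_synonym 'a mukai = "real \<times> 'a \<times> real"

definition mukai_vectors :: "'a set \<Rightarrow> 'a mukai set" where
  "mukai_vectors NS = \<int> \<times> NS \<times> \<int>"

definition mukai_rank :: "'a mukai \<Rightarrow> real" where
  "mukai_rank x = fst x"

definition ns_class :: "'a \<Rightarrow> 'a mukai" where
  "ns_class D = (0, D, 0)"

definition point_class :: "'a::zero mukai"  ("\<rho>\<^sub>X") where
  "\<rho>\<^sub>X = (0, 0, 1)"

definition mukai_pairing :: "('a \<Rightarrow> 'a \<Rightarrow> real) \<Rightarrow> 'a mukai \<Rightarrow> 'a mukai \<Rightarrow> real" where
  "mukai_pairing ip = (\<lambda>(x0, x1, x2) (y0, y1, y2). ip x1 y1 - (x0 * y2 + x2 * y0))"

definition mukai_exp :: "('a \<Rightarrow> 'a \<Rightarrow> real) \<Rightarrow> 'a \<Rightarrow> 'a mukai" where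
  "mukai_exp ip \<beta> = (1, \<beta>, ip \<beta> \<beta> / 2)"

text \<open>A pair \<open>(x, y)\<close> of real classes stands for the class \<open>x + \<i> y\<close> in NS(X) tensor C.\<close>

type_synonym 'a cmukai = "complex \<times> ('a \<times> 'a) \<times> complex"

definition ip_complex :: "('a \<Rightarrow> 'a \<Rightarrow> real) \<Rightarrow> 'a \<times> 'a \<Rightarrow> 'a \<times> 'a \<Rightarrow> complex" where
  "ip_complex ip = (\<lambda>(x, y) (u, w). Complex (ip x u - ip y w) (ip x w + ip y u))"

definition mukai_pairing_complex ::
    "('a \<Rightarrow> 'a \<Rightarrow> real) \<Rightarrow> 'a cmukai \<Rightarrow> 'a cmukai \<Rightarrow> complex" where
  "mukai_pairing_complex ip =
     (\<lambda>(x0, x1, x2) (y0, y1, y2). ip_complex ip x1 y1 - (x0 * y2 + x2 * y0))"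

definition mukai_exp_complex :: "('a \<Rightarrow> 'a \<Rightarrow> real) \<Rightarrow> 'a \<times> 'a \<Rightarrow> 'a cmukai" where
  "mukai_exp_complex ip \<gamma> = (1, \<gamma>, ip_complex ip \<gamma> \<gamma> / 2)"

definition complexify :: "'a::zero mukai \<Rightarrow> 'a cmukai" where
  "complexify = (\<lambda>(x0, x1, x2). (complex_of_real x0, (x1, 0), complex_of_real x2))"

text \<open>
  Z may vanish on a class of negative square: with \<open>(H\<^sup>2) = 2\<close> and \<open>v = 1 + \<rho>\<^sub>X\<close> the value at
  \<open>(\<beta>, \<omega>) = (0, H)\<close> is 0.  There the real span of Z is a point and not a line.
\<close>

definition stability_function ::
    "('a::zero \<Rightarrow> 'a \<Rightarrow> real) \<Rightarrow> 'a \<Rightarrow> 'a \<Rightarrow> 'a mukai \<Rightarrow> complex" where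
  "stability_function ip \<beta> \<omega> v =
     mukai_pairing_complex ip (mukai_exp_complex ip (\<beta>, \<omega>)) (complexify v)"

end

theory Submission
  imports Defs
begin

text \<open>
  Multiplication by \<open>e\<^sup>-\<^sup>\<beta>\<close> is an isometry of the Mukai pairing, so
  \<open>Z\<close> at \<open>(\<beta> + s H, t H)\<close> of the class with data \<open>(r, d, D, a)\<close> is
  \<open>d (H\<^sup>2) \<gamma> - a - r (H\<^sup>2) \<gamma>\<^sup>2 / 2\<close> with \<open>\<gamma> = s + \<i> t\<close>; here \<open>D\<close> drops out since it is
  orthogonal to \<open>H\<close>.  Two nonzero complex numbers have the same real span iff the determinant of
  their real and imaginary parts vanishes.  For \<open>r = 0\<close> the terms linear in \<open>d\<^sub>2 s\<close> cancel
  in this determinant, and dividing it by \<open>d\<^sub>\<beta> r\<^sub>2 (H\<^sup>2) / 2\<close> gives the equation of the circle.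
\<close>

lemma span_singleton_eq_iff_complex:
  fixes z w :: complex
  assumes "z \<noteq> 0" "w \<noteq> 0"
  shows "span {z} = span {w} \<longleftrightarrow> Re z * Im w = Im z * Re w"
proof
  assume "span {z} = span {w}"
  then have "z \<in> span {w}"
    using span_base[of z "{z}"] by simp
  then obtain k where "z = k *\<^sub>R w"
    by (auto simp: span_singleton)
  then show "Re z * Im w = Im z * Re w"
    by simp
next
  assume det: "Re z * Im w = Im z * Re w"
  have real: "Im (z / w) = 0"
    using det by (simp add: Im_divide)
  then have z: "z = Re (z / w) *\<^sub>R w"
    using assms by (metis complex_is_Real_iff nonzero_eq_divide_eq of_real_Re scaleR_conv_of_real)
  then have "Re (z / w) \<noteq> 0"
    using assms by auto
  then have "w = inverse (Re (z / w)) *\<^sub>R z"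
    using z by (metis scaleR_left_imp_eq scaleR_one scaleR_scaleR left_inverse)
  then have "w \<in> span {z}"
    by (metis span_base span_scale singletonI)
  moreover have "z \<in> span {w}"
    using z by (metis span_base span_scale singletonI)
  ultimately show "span {z} = span {w}"
    by (simp add: span_eq)
qed

context abelian_surface_NS
begin

lemma ip_add_right: "ip x (y + z) = ip x y + ip x z"
  by (rule linear_add[OF ip_linear])

lemma ip_scale_right: "ip x (c *\<^sub>R y) = c * ip x y"
  using linear_scale[OF ip_linear] by simp

lemma ip_add_left: "ip (x + y) z = ip x z + ip y z"
  by (metis ip_add_right ip_sym)

lemma ip_scale_left: "ip (c *\<^sub>R x) y = c * ip x y"
  by (metis ip_scale_right ip_sym)

lemma ip_zero_right: "ip x 0 = 0"
  by (rule linear_0[OF ip_linear])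

lemmas ip_bilinear = ip_add_right ip_scale_right ip_add_left ip_scale_left ip_zero_right

lemma Ample_square_pos: "H \<in> Ample \<Longrightarrow> ip H H > 0"
  using Ample_iff by blast

definition mukai_of_data :: "'a \<Rightarrow> 'a \<Rightarrow> real \<Rightarrow> real \<Rightarrow> 'a \<Rightarrow> real \<Rightarrow> 'a mukai" where
  "mukai_of_data \<beta> H r d D a =
     r *\<^sub>R mukai_exp ip \<beta> + ns_class (d *\<^sub>R H + D)
       + ip (d *\<^sub>R H + D) \<beta> *\<^sub>R \<rho>\<^sub>X + a *\<^sub>R \<rho>\<^sub>X"

lemma stability_function_of_data:
  assumes "ip H D = 0"
  shows "stability_function ip (\<beta> + s *\<^sub>R H) (t *\<^sub>R H) (mukai_of_data \<beta> H r d D a)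
    = Complex (d * ip H H * s - a - r * ip H H * (s\<^sup>2 - t\<^sup>2) / 2) (t * ip H H * (d - r * s))"
  using assms
  by (simp add: stability_function_def mukai_of_data_def mukai_pairing_complex_def
      mukai_exp_complex_def complexify_def ip_complex_def mukai_exp_def ns_class_def
      point_class_def complex_eq_iff ip_bilinear ip_sym[of D H] ip_sym[of \<beta> H] ip_sym[of \<beta> D]
      field_simps power2_eq_square)

lemma mukai_square_of_data:
  assumes "ip H D = 0"
  shows "mukai_pairing ip (mukai_of_data \<beta> H r d D a) (mukai_of_data \<beta> H r d D a)
    = d\<^sup>2 * ip H H + ip D D - 2 * r * a"
  using assms
  by (simp add: mukai_of_data_def mukai_pairing_def mukai_exp_def ns_class_def point_class_def
      ip_bilinear ip_sym[of D H] ip_sym[of \<beta> H] ip_sym[of \<beta> D] field_simps power2_eq_square)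

end

lemma det_eq_circle_iff:
  fixes h d a r\<^sub>2 d\<^sub>2 a\<^sub>2 s t :: real
  assumes "h \<noteq> 0" "d \<noteq> 0" "r\<^sub>2 \<noteq> 0" "t \<noteq> 0"
  shows "(d * h * s - a) * (t * h * (d\<^sub>2 - r\<^sub>2 * s))
           = t * h * d * (d\<^sub>2 * h * s - a\<^sub>2 - r\<^sub>2 * h * (s\<^sup>2 - t\<^sup>2) / 2)
     \<longleftrightarrow> t\<^sup>2 + (s - a / (d * h))\<^sup>2
           = (a / (d * h) - d\<^sub>2 / r\<^sub>2)\<^sup>2 - (d\<^sub>2\<^sup>2 * h - 2 * r\<^sub>2 * a\<^sub>2) / (r\<^sub>2\<^sup>2 * h)"
    (is "?l = ?r \<longleftrightarrow> ?L = ?R")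
proof -
  have "?r - ?l = (t * h\<^sup>2 * d * r\<^sub>2 / 2) * (?L - ?R)"
    using assms by (simp add: field_simps power2_eq_square)
  then show ?thesis
    using assms by (metis eq_iff_diff_eq_0 divide_eq_0_iff mult_eq_0_iff power_not_zero zero_neq_numeral)
qed

theorem proposition5p8:
  fixes NS :: "'a::real_vector set"
    and ip :: "'a \<Rightarrow> 'a \<Rightarrow> real"
    and Ample :: "'a set"
    and H \<beta> D\<^sub>\<beta> D\<^sub>2 :: 'a
    and v v\<^sub>2 :: "'a mukai"
    and r d\<^sub>\<beta> a\<^sub>\<beta> r\<^sub>2 d\<^sub>2 a\<^sub>2 s t :: real
  assumes "abelian_surface_NS NS ip Ample"
    and "H \<in> Ample"
    and "v \<in> mukai_vectors NS" and "mukai_rank v = r"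
    and "v\<^sub>2 \<in> mukai_vectors NS" and "mukai_rank v\<^sub>2 = r\<^sub>2"
    and "ip H D\<^sub>\<beta> = 0" and "ip H D\<^sub>2 = 0"
    and "v = r *\<^sub>R mukai_exp ip \<beta> + ns_class (d\<^sub>\<beta> *\<^sub>R H + D\<^sub>\<beta>)
             + ip (d\<^sub>\<beta> *\<^sub>R H + D\<^sub>\<beta>) \<beta> *\<^sub>R \<rho>\<^sub>X + a\<^sub>\<beta> *\<^sub>R \<rho>\<^sub>X"
    and "v\<^sub>2 = r\<^sub>2 *\<^sub>R mukai_exp ip \<beta> + ns_class (d\<^sub>2 *\<^sub>R H + D\<^sub>2)
             + ip (d\<^sub>2 *\<^sub>R H + D\<^sub>2) \<beta> *\<^sub>R \<rho>\<^sub>X + a\<^sub>2 *\<^sub>R \<rho>\<^sub>X"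
    and "r = 0"
    and "mukai_pairing ip v v > 0"
    and "r * d\<^sub>2 - r\<^sub>2 * d\<^sub>\<beta> \<noteq> 0"
    and "t > 0"
    and "stability_function ip (\<beta> + s *\<^sub>R H) (t *\<^sub>R H) v\<^sub>2 \<noteq> 0"
  shows "span {stability_function ip (\<beta> + s *\<^sub>R H) (t *\<^sub>R H) v}
           = span {stability_function ip (\<beta> + s *\<^sub>R H) (t *\<^sub>R H) v\<^sub>2}
         \<longleftrightarrow>
         t\<^sup>2 + (s - a\<^sub>\<beta> / (d\<^sub>\<beta> * ip H H))\<^sup>2
           = (a\<^sub>\<beta> / (d\<^sub>\<beta> * ip H H) - d\<^sub>2 / r\<^sub>2)\<^sup>2
             - (mukai_pairing ip v\<^sub>2 v\<^sub>2 - ip D\<^sub>2 D\<^sub>2) / (r\<^sub>2\<^sup>2 * ip H H)"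
proof -
  interpret abelian_surface_NS NS ip Ample
    by fact
  have h: "ip H H > 0"
    using Ample_square_pos \<open>H \<in> Ample\<close> .
  have nz: "r\<^sub>2 \<noteq> 0" "d\<^sub>\<beta> \<noteq> 0"
    using \<open>r * d\<^sub>2 - r\<^sub>2 * d\<^sub>\<beta> \<noteq> 0\<close> \<open>r = 0\<close> by auto
  have v: "v = mukai_of_data \<beta> H 0 d\<^sub>\<beta> D\<^sub>\<beta> a\<^sub>\<beta>" and v\<^sub>2: "v\<^sub>2 = mukai_of_data \<beta> H r\<^sub>2 d\<^sub>2 D\<^sub>2 a\<^sub>2"
    using assms(9,10) \<open>r = 0\<close> by (simp_all add: mukai_of_data_def)
  let ?Z = "stability_function ip (\<beta> + s *\<^sub>R H) (t *\<^sub>R H)"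
  have Zv: "?Z v = Complex (d\<^sub>\<beta> * ip H H * s - a\<^sub>\<beta>) (t * ip H H * d\<^sub>\<beta>)"
    using stability_function_of_data[OF \<open>ip H D\<^sub>\<beta> = 0\<close>] v by simp
  have Zv\<^sub>2: "?Z v\<^sub>2 = Complex (d\<^sub>2 * ip H H * s - a\<^sub>2 - r\<^sub>2 * ip H H * (s\<^sup>2 - t\<^sup>2) / 2)
      (t * ip H H * (d\<^sub>2 - r\<^sub>2 * s))"
    using stability_function_of_data[OF \<open>ip H D\<^sub>2 = 0\<close>] v\<^sub>2 by simp
  have "?Z v \<noteq> 0"
    using Zv h nz \<open>t > 0\<close> by (simp add: complex_eq_iff)
  then have "span {?Z v} = span {?Z v\<^sub>2} \<longleftrightarrow> Re (?Z v) * Im (?Z v\<^sub>2) = Im (?Z v) * Re (?Z v\<^sub>2)"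
    using assms(15) by (rule span_singleton_eq_iff_complex)
  moreover have "mukai_pairing ip v\<^sub>2 v\<^sub>2 - ip D\<^sub>2 D\<^sub>2 = d\<^sub>2\<^sup>2 * ip H H - 2 * r\<^sub>2 * a\<^sub>2"
    using mukai_square_of_data[OF \<open>ip H D\<^sub>2 = 0\<close>] v\<^sub>2 by simp
  ultimately show ?thesis
    using det_eq_circle_iff[of "ip H H" d\<^sub>\<beta> r\<^sub>2 t] h nz \<open>t > 0\<close> unfolding Zv Zv\<^sub>2 by simp
qed

end
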